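(* Let $X$ be a bipartite distance-regular graph of diameter $d\geq 4$ on $n$ vertices. If a halved graph of $X$ is primitive, then $\mathrm{motion}(X)\geq (2d)^{-2d-5}\,n$.
   Context: A distance-regular graph of diameter $d$ is a connected graph such that for vertices $v,w$ at distance $i$ the numbers of neighbours of $w$ at distance $i-1,i,i+1$ from $v$ are constants $c_i,a_i,b_i$. It is primitive if for every $1\le i\le d$ the distance-$i$ graph (same vertices, $u\sim v$ iff $\mathrm{dist}(u,v)=i$) is connected. For bipartite $X$, the halved graphs are the two connected components of the distance-2 graph of $X$ (one on each colour class); they are distance-regular. The motion of a graph is the minimum, over non-identity automorphisms, of the number of vertices not fixed. *)

theory Defs
  imports Complex_Main "HOL-Library.Extended_Real"
begin

definition simple_graph :: "'a set \<Rightarrow> ('a \<Rightarrow> 'a \<Rightarrow> bool) \<Rightarrow> bool" where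
  "simple_graph V E \<longleftrightarrow> finite V \<and> (\<forall>u v. E u v \<longrightarrow> u \<in> V \<and> v \<in> V)
     \<and> (\<forall>u v. E u v \<longrightarrow> E v u) \<and> (\<forall>u. \<not> E u u)"

fun walk :: "'a set \<Rightarrow> ('a \<Rightarrow> 'a \<Rightarrow> bool) \<Rightarrow> nat \<Rightarrow> 'a \<Rightarrow> 'a \<Rightarrow> bool" where
  "walk V E 0 u v = (u = v \<and> u \<in> V)"
| "walk V E (Suc k) u v = (u \<in> V \<and> (\<exists>w\<in>V. E u w \<and> walk V E k w v))"

definition gdist :: "'a set \<Rightarrow> ('a \<Rightarrow> 'a \<Rightarrow> bool) \<Rightarrow> 'a \<Rightarrow> 'a \<Rightarrow> nat" where
  "gdist V E u v = (LEAST k. walk V E k u v)"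

definition connected_graph :: "'a set \<Rightarrow> ('a \<Rightarrow> 'a \<Rightarrow> bool) \<Rightarrow> bool" where
  "connected_graph V E \<longleftrightarrow> V \<noteq> {} \<and> (\<forall>u\<in>V. \<forall>v\<in>V. \<exists>k. walk V E k u v)"

definition diameter :: "'a set \<Rightarrow> ('a \<Rightarrow> 'a \<Rightarrow> bool) \<Rightarrow> nat" where
  "diameter V E = Max {gdist V E u v | u v. u \<in> V \<and> v \<in> V}"

definition distance_regular :: "'a set \<Rightarrow> ('a \<Rightarrow> 'a \<Rightarrow> bool) \<Rightarrow> bool" where
  "distance_regular V E \<longleftrightarrow> simple_graph V E \<and> connected_graph V E \<and>
     (\<exists>c a b :: nat \<Rightarrow> nat. \<forall>v\<in>V. \<forall>w\<in>V.
        let i = gdist V E v w in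
          card {x\<in>V. E w x \<and> gdist V E v x + 1 = i} = c i \<and>
          card {x\<in>V. E w x \<and> gdist V E v x = i} = a i \<and>
          card {x\<in>V. E w x \<and> gdist V E v x = i + 1} = b i)"

definition bipartite :: "'a set \<Rightarrow> ('a \<Rightarrow> 'a \<Rightarrow> bool) \<Rightarrow> bool" where
  "bipartite V E \<longleftrightarrow> (\<exists>A. A \<subseteq> V \<and> (\<forall>u v. E u v \<longrightarrow> (u \<in> A \<longleftrightarrow> v \<notin> A)))"

definition dist_graph :: "'a set \<Rightarrow> ('a \<Rightarrow> 'a \<Rightarrow> bool) \<Rightarrow> nat \<Rightarrow> 'a \<Rightarrow> 'a \<Rightarrow> bool" where
  "dist_graph V E i u v \<longleftrightarrow> u \<in> V \<and> v \<in> V \<and> gdist V E u v = i"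

definition primitive :: "'a set \<Rightarrow> ('a \<Rightarrow> 'a \<Rightarrow> bool) \<Rightarrow> bool" where
  "primitive V E \<longleftrightarrow> (\<forall>i. 1 \<le> i \<and> i \<le> diameter V E \<longrightarrow> connected_graph V (dist_graph V E i))"

definition component :: "'a set \<Rightarrow> ('a \<Rightarrow> 'a \<Rightarrow> bool) \<Rightarrow> 'a set \<Rightarrow> bool" where
  "component V E C \<longleftrightarrow> (\<exists>v\<in>V. C = {u\<in>V. \<exists>k. walk V E k v u})"

definition halved_graph :: "'a set \<Rightarrow> ('a \<Rightarrow> 'a \<Rightarrow> bool) \<Rightarrow> 'a set \<Rightarrow> ('a \<Rightarrow> 'a \<Rightarrow> bool) \<Rightarrow> bool" where
  "halved_graph V E C F \<longleftrightarrow> component V (dist_graph V E 2) C \<and>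
     F = (\<lambda>u v. u \<in> C \<and> v \<in> C \<and> dist_graph V E 2 u v)"

definition automorphism :: "'a set \<Rightarrow> ('a \<Rightarrow> 'a \<Rightarrow> bool) \<Rightarrow> ('a \<Rightarrow> 'a) \<Rightarrow> bool" where
  "automorphism V E \<sigma> \<longleftrightarrow> bij_betw \<sigma> V V \<and> (\<forall>u\<in>V. \<forall>v\<in>V. E u v \<longleftrightarrow> E (\<sigma> u) (\<sigma> v))"

text \<open>Motion: minimum number of moved vertices over non-identity automorphisms
  (infinity if there is none).\<close>
definition motion :: "'a set \<Rightarrow> ('a \<Rightarrow> 'a \<Rightarrow> bool) \<Rightarrow> ereal" where
  "motion V E = (INF \<sigma> \<in> {\<sigma>. automorphism V E \<sigma> \<and> (\<exists>v\<in>V. \<sigma> v \<noteq> v)}.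
                    ereal (real (card {v\<in>V. \<sigma> v \<noteq> v})))"

end

theory Submission
  imports Defs
begin

text \<open>
  Let \<open>\<sigma>\<close> be a non-identity automorphism with set \<open>S\<close> of moved vertices, and let \<open>m = n / 2\<close> be the
  size of a colour class. If \<open>\<sigma>\<close> swaps the classes, then \<open>S\<close> is everything; otherwise \<open>\<sigma>\<close> moves
  some \<open>u\<close> within the class \<open>A\<close> of the primitive halved graph: if it fixed \<open>A\<close> pointwise, a moved
  vertex would have all its neighbours fixed, giving \<open>k \<le> c\<^sub>2\<close>. Every vertex that is not
  equidistant from \<open>u\<close> and \<open>\<sigma> u\<close> lies in \<open>S\<close>. The number of vertices not equidistant from \<open>x\<close> and
  \<open>y\<close> depends only on the distance of \<open>x\<close> and \<open>y\<close>, so by primitivity it is at most \<open>(d + 1) |S|\<close>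
  for all \<open>x, y \<in> A\<close>. If this is small against \<open>m\<close>, averaging produces an even and an odd distance
  whose spheres have size at least \<open>3m/4\<close>.

  Let \<open>T\<close> be the smaller of these two distances. The sphere of radius \<open>T - 1\<close> has size at most
  \<open>m/4\<close>, hence \<open>3 c\<^sub>2 \<le> 3 c\<^sub>T \<le> b\<^bsub>T-1\<^esub>\<close>; here \<open>T \<ge> 2\<close> because \<open>d \<ge> 4\<close> forces \<open>2 k \<le> m\<close>. A moved
  vertex \<open>y\<close> has at most \<open>c\<^sub>2\<close> fixed neighbours, since these are common neighbours of \<open>y\<close> and
  \<open>\<sigma> y\<close>. Counting edges between consecutive spheres around \<open>u\<close>, the proportion of moved vertices
  is multiplied by at least \<open>2/3\<close> at each step, so \<open>S\<close> contains at least the fraction \<open>(2/3)\<^sup>T\<close> of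
  the sphere of radius \<open>T\<close>.
\<close>

section \<open>Counting tools\<close>

lemma double_count:
  assumes "finite P" "finite Q"
  shows "(\<Sum>x\<in>P. card {y \<in> Q. R x y}) = (\<Sum>y\<in>Q. card {x \<in> P. R x y})"
  using sum_multicount_gen[OF assms, of R "\<lambda>y. card {x \<in> P. R x y}"] by simp

lemma sum_if_const: "finite Q \<Longrightarrow> (\<Sum>z\<in>Q. if P z then k else 0) = card {z \<in> Q. P z} * (k::nat)"
  by (simp add: sum.inter_filter[symmetric])

section \<open>Distances in connected graphs\<close>

locale conn_graph =
  fixes V :: "'a set" and E :: "'a \<Rightarrow> 'a \<Rightarrow> bool"
  assumes simple: "simple_graph V E" and conn: "connected_graph V E"
begin

abbreviation D :: "'a \<Rightarrow> 'a \<Rightarrow> nat" where "D \<equiv> gdist V E"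

lemma finite_V [simp]: "finite V"
  and E_in_V: "E u v \<Longrightarrow> u \<in> V \<and> v \<in> V"
  and E_sym: "E u v \<Longrightarrow> E v u"
  and E_irrefl: "\<not> E u u"
  using simple unfolding simple_graph_def by blast+

lemma walk_in_V: "walk V E k u v \<Longrightarrow> u \<in> V \<and> v \<in> V"
  by (induction k arbitrary: u) auto

lemma walk_append: "walk V E k u v \<Longrightarrow> walk V E l v w \<Longrightarrow> walk V E (k + l) u w"
  by (induction k arbitrary: u) auto

lemma walk_sym: "walk V E k u v \<Longrightarrow> walk V E k v u"
proof (induction k arbitrary: u)
  case (Suc k)
  then obtain w where w: "w \<in> V" "E u w" "walk V E k w v" "u \<in> V" by auto
  have "walk V E 1 w u" using w E_sym by auto
  from walk_append[OF Suc.IH[OF w(3)] this] show ?case by simp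
qed auto

lemma walk_dist: "x \<in> V \<Longrightarrow> y \<in> V \<Longrightarrow> walk V E (D x y) x y"
  using conn unfolding connected_graph_def gdist_def by (meson LeastI)

lemma dist_le: "walk V E k x y \<Longrightarrow> D x y \<le> k"
  unfolding gdist_def by (rule Least_le)

lemma dist_self [simp]: "x \<in> V \<Longrightarrow> D x x = 0"
  using dist_le[of 0 x x] by simp

lemma dist_eq_0: "x \<in> V \<Longrightarrow> y \<in> V \<Longrightarrow> D x y = 0 \<longleftrightarrow> x = y"
  using walk_dist[of x y] by auto

lemma dist_sym: "D x y = D y x"
proof -
  have "walk V E k x y = walk V E k y x" for k using walk_sym by blast
  then show ?thesis unfolding gdist_def by simp
qed

lemma dist_triangle: "x \<in> V \<Longrightarrow> y \<in> V \<Longrightarrow> z \<in> V \<Longrightarrow> D x z \<le> D x y + D y z"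
  by (intro dist_le walk_append[of _ x y]) (auto intro: walk_dist)

lemma dist_edge: "E x y \<Longrightarrow> D x y = 1"
proof -
  assume e: "E x y"
  then have "walk V E 1 x y" using E_in_V by auto
  then have "D x y \<le> 1" by (rule dist_le)
  moreover have "D x y \<noteq> 0" using e E_in_V dist_eq_0 E_irrefl by blast
  ultimately show ?thesis by simp
qed

lemma dist_1_edge: "x \<in> V \<Longrightarrow> y \<in> V \<Longrightarrow> D x y = 1 \<Longrightarrow> E x y"
  using walk_dist[of x y] by auto

text \<open>Cut a shortest walk after \<open>i\<close> steps; the triangle inequality forces both
  pieces to be shortest.\<close>

lemma dist_split:
  assumes "x \<in> V" "y \<in> V" "D x y = i + j"
  obtains z where "z \<in> V" "D x z = i" "D z y = j"
proof -
  have "walk V E (i + j) u y \<Longrightarrow> \<exists>z\<in>V. walk V E i u z \<and> walk V E j z y" for u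
    by (induction i arbitrary: u) (fastforce dest: walk_in_V)+
  then obtain z where z: "z \<in> V" "walk V E i x z" "walk V E j z y"
    using walk_dist[OF assms(1,2)] assms(3) by auto
  then have "D x z \<le> i" "D z y \<le> j" by (auto intro: dist_le)
  moreover have "i + j \<le> D x z + D z y" using dist_triangle[of x z y] assms z by auto
  ultimately show ?thesis using that[OF z(1)] by simp
qed

lemma dist_le_diameter: "x \<in> V \<Longrightarrow> y \<in> V \<Longrightarrow> D x y \<le> diameter V E"
proof -
  assume "x \<in> V" "y \<in> V"
  have "{D u v |u v. u \<in> V \<and> v \<in> V} = (\<lambda>(u, v). D u v) ` (V \<times> V)" by auto
  then have "finite {D u v |u v. u \<in> V \<and> v \<in> V}" by simp
  then show ?thesis unfolding diameter_def using \<open>x \<in> V\<close> \<open>y \<in> V\<close> by (intro Max_ge) auto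
qed

lemma diameter_attained: obtains x y where "x \<in> V" "y \<in> V" "D x y = diameter V E"
proof -
  have eq: "{D u v |u v. u \<in> V \<and> v \<in> V} = (\<lambda>(u, v). D u v) ` (V \<times> V)" by auto
  have "V \<noteq> {}" using conn unfolding connected_graph_def by blast
  then have "diameter V E \<in> {D u v |u v. u \<in> V \<and> v \<in> V}"
    unfolding diameter_def eq by (intro Max_in) auto
  then show ?thesis using that by auto
qed

lemma automorphism_dist:
  assumes "automorphism V E \<sigma>" "x \<in> V" "y \<in> V"
  shows "D (\<sigma> x) (\<sigma> y) = D x y"
proof -
  have bij: "bij_betw \<sigma> V V" and pres: "\<And>u v. u \<in> V \<Longrightarrow> v \<in> V \<Longrightarrow> E u v \<longleftrightarrow> E (\<sigma> u) (\<sigma> v)"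
    using assms(1) unfolding automorphism_def by auto
  have im: "\<sigma> ` V = V" and inj: "inj_on \<sigma> V" using bij by (auto simp: bij_betw_def)
  have "walk V E k (\<sigma> u) (\<sigma> y) \<longleftrightarrow> walk V E k u y" if "u \<in> V" for k u
    using that
  proof (induction k arbitrary: u)
    case 0
    then show ?case using inj assms(3) im by (auto simp: inj_on_def)
  next
    case (Suc k)
    \<comment> \<open>Surjectivity of \<sigma> lets the next vertex of the walk be taken as an
      image.\<close>
    have "(\<exists>w\<in>V. E (\<sigma> u) w \<and> walk V E k w (\<sigma> y)) \<longleftrightarrow>
          (\<exists>w\<in>\<sigma> ` V. E (\<sigma> u) w \<and> walk V E k w (\<sigma> y))" by (simp add: im)
    also have "\<dots> \<longleftrightarrow> (\<exists>w\<in>V. E u w \<and> walk V E k w y)" using Suc pres by auto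
    finally show ?case using Suc.prems im by auto
  qed
  then show ?thesis using assms(2) unfolding gdist_def by simp
qed

end

section \<open>Bipartite graphs and their halved graphs\<close>

locale bip_graph = conn_graph +
  fixes A :: "'a set"
  assumes A_sub: "A \<subseteq> V" and colour: "E u v \<Longrightarrow> u \<in> A \<longleftrightarrow> v \<notin> A"
begin

lemma finite_A [simp]: "finite A"
  by (rule finite_subset[OF A_sub finite_V])

lemma dist_parity: "x \<in> V \<Longrightarrow> y \<in> V \<Longrightarrow> even (D x y) \<longleftrightarrow> (x \<in> A \<longleftrightarrow> y \<in> A)"
proof -
  assume "x \<in> V" "y \<in> V"
  have "walk V E k u y \<Longrightarrow> even k \<longleftrightarrow> (u \<in> A \<longleftrightarrow> y \<in> A)" for k u
    by (induction k arbitrary: u) (auto dest: colour)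
  then show ?thesis using walk_dist \<open>x \<in> V\<close> \<open>y \<in> V\<close> by blast
qed

text \<open>Parity excludes equal distances, so all numbers a_i vanish and only c_i and b_i
  remain.\<close>

lemma dist_adjacent:
  assumes "x \<in> V" "E y z"
  shows "D x z = D x y + 1 \<or> D x z + 1 = D x y"
proof -
  have V: "y \<in> V" "z \<in> V" using E_in_V assms by auto
  have "D x z \<le> D x y + 1" "D x y \<le> D x z + 1"
    using dist_triangle[of x y z] dist_triangle[of x z y] V assms dist_edge[OF assms(2)]
      dist_sym[of z y] by auto
  moreover have "D x z \<noteq> D x y"
    using dist_parity[of x y] dist_parity[of x z] V assms colour by metis
  ultimately show ?thesis by auto
qed

text \<open>Steps of length two keep the colour, and a shortest walk of even length splits into such
  steps, so a component is a colour class.\<close>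

lemma component_dist2:
  assumes "component V (dist_graph V E 2) C"
  obtains v where "v \<in> V" "C = {y \<in> V. even (D v y)}"
proof -
  obtain v where v: "v \<in> V" "C = {u\<in>V. \<exists>k. walk V (dist_graph V E 2) k v u}"
    using assms unfolding component_def by auto
  have 1: "even (D u y)" if "walk V (dist_graph V E 2) k u y" for k u y
    using that
  proof (induction k arbitrary: u)
    case (Suc k)
    then obtain w where w: "u \<in> V" "w \<in> V" "dist_graph V E 2 u w"
      "walk V (dist_graph V E 2) k w y" by auto
    have "y \<in> V" using w(4,2) by (induction k arbitrary: w) auto
    then show ?case using Suc.IH[OF w(4)] dist_parity[of u w] dist_parity[of u y] dist_parity[of w y] w
      by (auto simp: dist_graph_def)
  qed auto
  have 2: "\<exists>k. walk V (dist_graph V E 2) k u y" if "u \<in> V" "y \<in> V" "D u y = 2 * l" for l u y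
    using that
  proof (induction l arbitrary: u)
    case 0
    then have "walk V (dist_graph V E 2) 0 u y" by (simp add: dist_eq_0)
    then show ?case ..
  next
    case (Suc l)
    then obtain z where z: "z \<in> V" "D u z = 2" "D z y = 2 * l"
      using dist_split[of u y 2 "2 * l"] by auto
    from Suc.IH[OF this(1) Suc.prems(2) this(3)] obtain k where "walk V (dist_graph V E 2) k z y" ..
    then have "walk V (dist_graph V E 2) (Suc k) u y" using z Suc.prems by (auto simp: dist_graph_def)
    then show ?case ..
  qed
  have "C = {y \<in> V. even (D v y)}" using v 1 2 by (auto elim!: evenE)
  with v(1) show ?thesis by (rule that)
qed

text \<open>A shortest walk taken two edges at a time is a walk in the halved graph, and each step
  there costs two edges. This translates primitivity of \<open>F\<close> into a statement about
  \<open>D\<close>.\<close>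

lemma halved_dist:
  assumes F: "F = (\<lambda>u v. u \<in> A \<and> v \<in> A \<and> dist_graph V E 2 u v)" and xy: "x \<in> A" "y \<in> A"
  shows "D x y = 2 * gdist A F x y" "\<exists>k. walk A F k x y"
proof -
  have AV: "\<And>u. u \<in> A \<Longrightarrow> u \<in> V" using A_sub by blast
  have 1: "D u y \<le> 2 * k" if "walk A F k u y" for k u
    using that
  proof (induction k arbitrary: u)
    case (Suc k)
    then obtain w where w: "u \<in> A" "w \<in> A" "D u w = 2" "walk A F k w y"
      by (auto simp: dist_graph_def F)
    then show ?case using Suc.IH[OF w(4)] dist_triangle[of u w y] AV xy by auto
  qed (use AV in auto)
  have 2: "walk A F l u y" if "u \<in> A" "D u y = 2 * l" for l u
    using that
  proof (induction l arbitrary: u)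
    case 0
    then show ?case using dist_eq_0[of u y] AV xy by simp
  next
    case (Suc l)
    then obtain z where z: "z \<in> V" "D u z = 2" "D z y = 2 * l"
      using dist_split[of u y 2 "2 * l"] AV xy by auto
    then have "z \<in> A" using dist_parity[of u z] Suc.prems AV by auto
    then show ?case using Suc.IH z Suc.prems AV by (auto simp: F dist_graph_def)
  qed
  obtain l where l: "D x y = 2 * l" using dist_parity[of x y] AV xy by (auto elim: evenE)
  have "gdist A F x y = l"
    unfolding gdist_def by (rule Least_equality) (use 1 2 xy l in fastforce)+
  with l show "D x y = 2 * gdist A F x y" by simp
  show "\<exists>k. walk A F k x y" using 2[OF xy(1) l] ..
qed

end

section \<open>Intersection numbers of a bipartite distance-regular graph\<close>

locale bip_drg = bip_graph +
  fixes c b :: "nat \<Rightarrow> nat"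
  assumes c_count: "v \<in> V \<Longrightarrow> w \<in> V \<Longrightarrow> card {x\<in>V. E w x \<and> D v x + 1 = D v w} = c (D v w)"
    and b_count: "v \<in> V \<Longrightarrow> w \<in> V \<Longrightarrow> card {x\<in>V. E w x \<and> D v x = D v w + 1} = b (D v w)"
begin

lemma degree: "y \<in> V \<Longrightarrow> card {x\<in>V. E y x} = b 0"
proof -
  assume y: "y \<in> V"
  have "{x\<in>V. E y x} = {x\<in>V. E y x \<and> D y x = D y y + 1}" using y dist_edge by auto
  then show ?thesis using b_count[OF y y] y by simp
qed

lemma neighbours_split:
  assumes "x \<in> V" "y \<in> V"
  shows "{w\<in>V. E y w} = {w\<in>V. E y w \<and> D x w + 1 = D x y} \<union> {w\<in>V. E y w \<and> D x w = D x y + 1}"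
  using dist_adjacent[OF assms(1)] by auto

lemma sum_neighbours:
  fixes g :: "nat \<Rightarrow> nat"
  assumes "x \<in> V" "y \<in> V"
  shows "(\<Sum>w | w \<in> V \<and> E y w. g (D x w)) =
    c (D x y) * g (D x y - 1) + b (D x y) * g (D x y + 1)"
proof -
  let ?P = "{w\<in>V. E y w \<and> D x w + 1 = D x y}" and ?Q = "{w\<in>V. E y w \<and> D x w = D x y + 1}"
  have "(\<Sum>w | w \<in> V \<and> E y w. g (D x w)) = (\<Sum>w\<in>?P. g (D x w)) + (\<Sum>w\<in>?Q. g (D x w))"
    unfolding neighbours_split[OF assms] by (rule sum.union_disjoint) auto
  also have "(\<Sum>w\<in>?P. g (D x w)) = (\<Sum>w\<in>?P. g (D x y - 1))"
    by (rule sum.cong) (auto dest: sym)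
  also have "(\<Sum>w\<in>?Q. g (D x w)) = (\<Sum>w\<in>?Q. g (D x y + 1))"
    by (rule sum.cong) auto
  finally show ?thesis using c_count[OF assms] b_count[OF assms] by simp
qed

lemma c_plus_b: "x \<in> V \<Longrightarrow> y \<in> V \<Longrightarrow> c (D x y) + b (D x y) = b 0"
  using sum_neighbours[of x y "\<lambda>_. 1"] degree[of y] by simp

lemma c_pos: "x \<in> V \<Longrightarrow> y \<in> V \<Longrightarrow> D x y = Suc i \<Longrightarrow> 0 < c (Suc i)"
proof -
  assume a: "x \<in> V" "y \<in> V" "D x y = Suc i"
  then obtain z where z: "z \<in> V" "D x z = i" "D z y = 1" using dist_split[of x y i 1] by auto
  then have "z \<in> {w\<in>V. E y w \<and> D x w + 1 = D x y}" using a dist_1_edge E_sym by auto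
  then have "card {w\<in>V. E y w \<and> D x w + 1 = D x y} > 0" by (auto simp: card_gt_0_iff)
  then show ?thesis using c_count[of x y] a by simp
qed

lemma b_pos: "x \<in> V \<Longrightarrow> y \<in> V \<Longrightarrow> D x y = Suc i \<Longrightarrow> 0 < b i"
proof -
  assume a: "x \<in> V" "y \<in> V" "D x y = Suc i"
  then obtain z where z: "z \<in> V" "D x z = i" "D z y = 1" using dist_split[of x y i 1] by auto
  then have "y \<in> {w\<in>V. E z w \<and> D x w = D x z + 1}" using a dist_1_edge by auto
  then have "card {w\<in>V. E z w \<and> D x w = D x z + 1} > 0" by (auto simp: card_gt_0_iff)
  then show ?thesis using b_count[of x z] a z by simp
qed

text \<open>Move \<open>x\<close> one step towards \<open>y\<close>, to \<open>x'\<close>: a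
  neighbour of \<open>y\<close> that is nearer to \<open>x'\<close> than \<open>y\<close> is also
  nearer to \<open>x\<close>.\<close>

lemma c_mono_Suc:
  assumes "x \<in> V" "y \<in> V" "D x y = Suc i"
  shows "c i \<le> c (Suc i)"
proof -
  obtain x' where x': "x' \<in> V" "D x x' = 1" "D x' y = i"
    using dist_split[of x y 1 i] assms by auto
  have "{w\<in>V. E y w \<and> D x' w + 1 = D x' y} \<subseteq> {w\<in>V. E y w \<and> D x w + 1 = D x y}"
    using dist_adjacent[OF assms(1), of y] dist_triangle[OF assms(1) x'(1)] x' assms by fastforce
  then have "card {w\<in>V. E y w \<and> D x' w + 1 = D x' y} \<le> card {w\<in>V. E y w \<and> D x w + 1 = D x y}"
    by (intro card_mono) auto
  then show ?thesis using c_count[of x' y] c_count[of x y] assms x' by simp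
qed

lemma b_antimono_Suc:
  assumes "x \<in> V" "y \<in> V" "D x y = Suc i"
  shows "b (Suc i) \<le> b i"
proof -
  have "c i + b i = b 0"
    using dist_split[of x y i 1] c_plus_b assms by (metis Suc_eq_plus1)
  moreover have "c (Suc i) + b (Suc i) = b 0" using c_plus_b[of x y] assms by simp
  ultimately show ?thesis using c_mono_Suc[OF assms] by simp
qed

lemma c_mono:
  assumes "x \<in> V" "y \<in> V" "i \<le> D x y"
  shows "c i \<le> c (D x y)"
proof -
  have "i \<le> j \<Longrightarrow> j \<le> D x y \<Longrightarrow> c i \<le> c j" for j
  proof (induction j rule: dec_induct)
    case (step n)
    obtain z where "z \<in> V" "D x z = Suc n"
      using dist_split[of x y "Suc n" "D x y - Suc n"] assms step by auto
    then show ?case using c_mono_Suc[of x z n] step assms by auto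
  qed simp
  then show ?thesis using assms by simp
qed

lemma b_antimono:
  assumes "x \<in> V" "y \<in> V" "i \<le> j" "j \<le> D x y"
  shows "b j \<le> b i"
  using assms(3,4)
proof (induction j rule: dec_induct)
  case (step n)
  obtain z where "z \<in> V" "D x z = Suc n"
    using dist_split[of x y "Suc n" "D x y - Suc n"] assms step by auto
  then show ?case using b_antimono_Suc[of x z n] step assms by auto
qed simp

text \<open>Induction on \<open>j\<close>. Counting in two ways the pairs \<open>(z, w)\<close> with
  \<open>D x z = i\<close>, \<open>D z w = l\<close> and \<open>w\<close> adjacent to
  \<open>y\<close> gives the three-term recurrence \<open>key\<close>, which determines the count
  for \<open>Suc l\<close> from those for \<open>l\<close> and \<open>l - 1\<close>.\<close>

lemma intersection_number:
  "\<exists>g. \<forall>x\<in>V. \<forall>y\<in>V. card {z\<in>V. D x z = i \<and> D z y = j} = g (D x y)"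
proof (induction j rule: less_induct)
  case (less j)
  let ?N = "\<lambda>j x y. card {z\<in>V. D x z = i \<and> D z y = j}"
  show ?case
  proof (cases j)
    case 0
    have "?N 0 x y = (if D x y = i then 1 else 0)" if "x \<in> V" "y \<in> V" for x y
    proof -
      have "{z\<in>V. D x z = i \<and> D z y = 0} = (if D x y = i then {y} else {})"
        using that dist_eq_0 by auto
      then show ?thesis by simp
    qed
    then show ?thesis unfolding 0 by (intro exI[of _ "\<lambda>h. if h = i then 1 else 0"]) simp
  next
    case (Suc l)
    obtain g where g: "\<And>x y. x \<in> V \<Longrightarrow> y \<in> V \<Longrightarrow> ?N l x y = g (D x y)"
      using less[of l] Suc by auto
    obtain g' where g': "\<And>x y. l > 0 \<Longrightarrow> x \<in> V \<Longrightarrow> y \<in> V \<Longrightarrow> ?N (l - 1) x y = g' (D x y)"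
    proof (cases "l = 0")
      case False
      have "l - 1 < j" using Suc by simp
      from less[OF this] obtain h where "\<forall>x\<in>V. \<forall>y\<in>V. ?N (l - 1) x y = h (D x y)" ..
      then show thesis using that[of h] by blast
    qed simp
    \<comment> \<open>The contribution of the \<open>z\<close> with \<open>D z y + 1 = l\<close>.
      There are none for \<open>l = 0\<close>, where \<open>l - 1\<close> would be truncated to
      0.\<close>
    define r where "r h = (if l = 0 then 0 else b (l - 1) * g' h)" for h
    have key: "c (D x y) * g (D x y - 1) + b (D x y) * g (D x y + 1) =
        c (Suc l) * ?N (Suc l) x y + r (D x y)" if V: "x \<in> V" "y \<in> V" for x y
    proof -
      let ?Q = "{z\<in>V. D x z = i}"
      have cnt: "card {w \<in> {w\<in>V. E y w}. D z w = l} =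
          (if D z y = Suc l then c (Suc l) else 0) + (if D z y + 1 = l then b (l - 1) else 0)"
        if z: "z \<in> V" for z
      proof -
        consider "D z y = Suc l" | "D z y + 1 = l" | "D z y \<noteq> Suc l" "D z y + 1 \<noteq> l" by blast
        then show ?thesis
        proof cases
          case 1
          then have "{w \<in> {w\<in>V. E y w}. D z w = l} = {w\<in>V. E y w \<and> D z w + 1 = D z y}" by auto
          then show ?thesis using 1 c_count[OF z V(2)] by simp
        next
          case 2
          then have "{w \<in> {w\<in>V. E y w}. D z w = l} = {w\<in>V. E y w \<and> D z w = D z y + 1}" by auto
          then have "card {w \<in> {w\<in>V. E y w}. D z w = l} = b (D z y)"
            using b_count[OF z V(2)] by (simp only:)
          moreover have "l = Suc (D z y)" using 2 by simp
          ultimately show ?thesis by simp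
        next
          case 3
          have "D z w \<noteq> l" if "E y w" for w using dist_adjacent[OF z that] 3 by linarith
          then have "{w \<in> {w\<in>V. E y w}. D z w = l} = {}" by blast
          then show ?thesis using 3 by (simp only: card.empty if_False)
        qed
      qed
      have "(\<Sum>w | w \<in> V \<and> E y w. ?N l x w) = (\<Sum>w | w \<in> V \<and> E y w. card {z \<in> ?Q. D z w = l})"
        by (intro sum.cong refl arg_cong[where f = card]) auto
      also have "\<dots> = (\<Sum>z\<in>?Q. card {w \<in> {w\<in>V. E y w}. D z w = l})"
        by (rule double_count) auto
      also have "\<dots> = (\<Sum>z\<in>?Q. (if D z y = Suc l then c (Suc l) else 0) +
          (if D z y + 1 = l then b (l - 1) else 0))"
        by (rule sum.cong) (use cnt in auto)
      also have "\<dots> = card {z \<in> ?Q. D z y = Suc l} * c (Suc l) +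
          card {z \<in> ?Q. D z y + 1 = l} * b (l - 1)"
        by (simp only: sum.distrib) (subst (1 2) sum_if_const; simp)
      also have "card {z \<in> ?Q. D z y = Suc l} = ?N (Suc l) x y"
        by (rule arg_cong[where f = card]) auto
      also have "card {z \<in> ?Q. D z y + 1 = l} * b (l - 1) = r (D x y)"
      proof (cases "l = 0")
        case False
        then have "{z \<in> ?Q. D z y + 1 = l} = {z\<in>V. D x z = i \<and> D z y = l - 1}" by auto
        then show ?thesis using g'[of x y] False V unfolding r_def by simp
      qed (simp add: r_def)
      finally have "(\<Sum>w | w \<in> V \<and> E y w. ?N l x w) = c (Suc l) * ?N (Suc l) x y + r (D x y)"
        by simp
      moreover have "(\<Sum>w | w \<in> V \<and> E y w. ?N l x w) = (\<Sum>w | w \<in> V \<and> E y w. g (D x w))"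
        by (rule sum.cong) (use g V in auto)
      ultimately show ?thesis using sum_neighbours[OF V, of g] by simp
    qed
    \<comment> \<open>Solves \<open>key\<close> for the new count; the division is exact. If
      \<open>c (Suc l) = 0\<close>, then by \<open>c_pos\<close> no two vertices are at distance
      \<open>Suc l\<close>, so the default 0 is the true count.\<close>
    define G where "G h = (if c (Suc l) = 0 then 0
      else (c h * g (h - 1) + b h * g (h + 1) - r h) div c (Suc l))" for h
    have "?N (Suc l) x y = G (D x y)" if V: "x \<in> V" "y \<in> V" for x y
    proof (cases "c (Suc l) = 0")
      case True
      then have "{z\<in>V. D x z = i \<and> D z y = Suc l} = {}" using c_pos[of _ y l] V by auto
      then show ?thesis using True unfolding G_def by simp
    next
      case False
      then show ?thesis unfolding G_def key[OF V] by simp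
    qed
    then show ?thesis unfolding Suc by blast
  qed
qed

section \<open>Sphere sizes\<close>

definition sphere :: "nat \<Rightarrow> nat" where
  "sphere j = card {z\<in>V. D (SOME x. x \<in> V) z = j}"

text \<open>The size is the intersection number for the pair \<open>(x, x)\<close>, so the base
  vertex chosen in \<open>sphere\<close> does not matter.\<close>

lemma card_sphere: "x \<in> V \<Longrightarrow> card {z\<in>V. D x z = j} = sphere j"
proof -
  assume x: "x \<in> V"
  obtain g where g: "\<And>x y. x \<in> V \<Longrightarrow> y \<in> V \<Longrightarrow> card {z\<in>V. D x z = j \<and> D z y = j} = g (D x y)"
    using intersection_number[of j j] by auto
  have *: "card {z\<in>V. D x z = j} = g 0" if "x \<in> V" for x
  proof -
    have "{z\<in>V. D x z = j} = {z\<in>V. D x z = j \<and> D z x = j}" using dist_sym by auto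
    then show ?thesis using g[of x x] that by simp
  qed
  show ?thesis unfolding sphere_def using *[OF x] *[OF someI[of "\<lambda>x. x \<in> V", OF x]] by simp
qed

text \<open>Both sides count the edges between two consecutive spheres.\<close>

lemma sphere_rec: "sphere i * b i = sphere (Suc i) * c (Suc i)"
proof -
  obtain x where x: "x \<in> V" using conn unfolding connected_graph_def by blast
  let ?P = "{z\<in>V. D x z = i}" and ?Q = "{z\<in>V. D x z = Suc i}"
  have "card {w \<in> ?Q. E z w} = b i" if "z \<in> ?P" for z
  proof -
    have "{w \<in> ?Q. E z w} = {w\<in>V. E z w \<and> D x w = D x z + 1}" using that by auto
    then show ?thesis using b_count[of x z] that x by simp
  qed
  moreover have "card {z \<in> ?P. E z w} = c (Suc i)" if "w \<in> ?Q" for w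
  proof -
    have "{z \<in> ?P. E z w} = {z\<in>V. E w z \<and> D x z + 1 = D x w}" using that E_sym by auto
    then show ?thesis using c_count[of x w] that x by simp
  qed
  ultimately show ?thesis using double_count[of ?P ?Q E] card_sphere[OF x] by simp
qed

section \<open>Vertices that distinguish two given vertices\<close>

definition disc :: "'a \<Rightarrow> 'a \<Rightarrow> nat" where
  "disc x y = card {z\<in>V. D x z \<noteq> D y z}"

text \<open>The complementary set, of vertices equidistant from \<open>x\<close> and
  \<open>y\<close>, splits by the common distance \<open>j\<close> into parts whose sizes are
  intersection numbers.\<close>

lemma disc_cong:
  assumes "x \<in> V" "y \<in> V" "x' \<in> V" "y' \<in> V" "D x y = D x' y'"
  shows "disc x y = disc x' y'"
proof -
  let ?I = "\<lambda>x y. {z\<in>V. D x z = D y z}" and ?N = "\<lambda>j x y. {z\<in>V. D x z = j \<and> D z y = j}"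
  have eq: "card (?I x y) = (\<Sum>j\<le>diameter V E. card (?N j x y))" if "x \<in> V" "y \<in> V" for x y
  proof -
    have "?I x y = (\<Union>j\<in>{..diameter V E}. ?N j x y)"
      using dist_le_diameter that dist_sym[of y] by auto
    then show ?thesis by (simp only:) (rule card_UN_disjoint; auto)
  qed
  have "card (?N j x y) = card (?N j x' y')" for j
  proof -
    obtain g where "\<forall>x\<in>V. \<forall>y\<in>V. card (?N j x y) = g (D x y)" using intersection_number[of j j] ..
    then show ?thesis using assms by simp
  qed
  then have "card (?I x y) = card (?I x' y')" using eq assms by simp
  moreover have "disc x y = card V - card (?I x y)" for x y
  proof -
    have "{z\<in>V. D x z \<noteq> D y z} = V - ?I x y" by auto
    then show ?thesis unfolding disc_def by (simp add: card_Diff_subset)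
  qed
  ultimately show ?thesis by simp
qed

lemma disc_triangle: "disc x z \<le> disc x y + disc y z"
proof -
  have "disc x z \<le> card ({w\<in>V. D x w \<noteq> D y w} \<union> {w\<in>V. D y w \<noteq> D z w})"
    unfolding disc_def by (intro card_mono) auto
  also have "\<dots> \<le> disc x y + disc y z" unfolding disc_def by (rule card_Un_le)
  finally show ?thesis .
qed

lemma disc_pos: "u \<in> V \<Longrightarrow> v \<in> V \<Longrightarrow> u \<noteq> v \<Longrightarrow> 0 < disc u v"
proof -
  assume a: "u \<in> V" "v \<in> V" "u \<noteq> v"
  then have "u \<in> {z\<in>V. D u z \<noteq> D v z}" using dist_eq_0[of v u] by auto
  then show ?thesis unfolding disc_def by (auto simp: card_gt_0_iff)
qed

lemma disc_self [simp]: "disc x x = 0"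
  by (simp add: disc_def)

text \<open>At most \<open>d\<close> positive values of \<open>disc\<close> exist, so one of the \<open>d + 1\<close> consecutive intervals
  of length \<open>disc u v\<close> above \<open>0\<close> contains none of them; a path with steps at distance
  \<open>D u v\<close> cannot jump over such a gap.\<close>

lemma disc_le_of_connected:
  assumes uv: "u \<in> A" "v \<in> A" "u \<noteq> v"
    and R: "connected_graph A R" "\<And>x y. R x y \<Longrightarrow> D x y = D u v"
    and pq: "p \<in> A" "q \<in> A"
  shows "disc p q \<le> (diameter V E + 1) * disc u v"
proof (rule ccontr)
  assume big: "\<not> ?thesis"
  let ?d = "diameter V E" and ?f = "disc u v"
  have AV: "\<And>x. x \<in> A \<Longrightarrow> x \<in> V" using A_sub by auto
  have f: "?f > 0" using disc_pos uv AV by blast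
  define Z where "Z = {disc x y |x y. x \<in> A \<and> y \<in> A \<and> x \<noteq> y}"
  \<comment> \<open>By \<open>disc_cong\<close>, \<open>disc\<close> factors through the distance;
    any representative pair computes the factor. Hence \<open>Z\<close> has at most one value per
    positive distance.\<close>
  define \<phi> where "\<phi> h = (let e = (SOME e. fst e \<in> V \<and> snd e \<in> V \<and> D (fst e) (snd e) = h)
    in disc (fst e) (snd e))" for h
  have \<phi>: "disc x y = \<phi> (D x y)" if "x \<in> V" "y \<in> V" for x y
  proof -
    define e where "e = (SOME e. fst e \<in> V \<and> snd e \<in> V \<and> D (fst e) (snd e) = D x y)"
    have "fst e \<in> V \<and> snd e \<in> V \<and> D (fst e) (snd e) = D x y"
      unfolding e_def by (rule someI[of _ "(x, y)"]) (use that in auto)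
    then show ?thesis using disc_cong[of x y "fst e" "snd e"] that
      unfolding \<phi>_def e_def[symmetric] Let_def by simp
  qed
  have "Z \<subseteq> \<phi> ` {1..?d}"
  proof
    fix s assume "s \<in> Z"
    then obtain x y where xy: "x \<in> V" "y \<in> V" "x \<noteq> y" "s = disc x y" using AV unfolding Z_def by auto
    then have "D x y \<in> {1..?d}" using dist_eq_0[of x y] dist_le_diameter[of x y] by auto
    then show "s \<in> \<phi> ` {1..?d}" using \<phi>[of x y] xy by auto
  qed
  then have Z: "finite Z" "card Z \<le> ?d"
    using finite_surj[of "{1..?d}"] surj_card_le[of "{1..?d}" Z \<phi>] by auto
  have "\<exists>s\<le>?d. \<forall>w\<in>Z. \<not> (s * ?f < w \<and> w \<le> Suc s * ?f)"
  proof (rule ccontr)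
    assume "\<not> ?thesis"
    then have "\<forall>s\<in>{..?d}. \<exists>w. w \<in> Z \<and> s * ?f < w \<and> w \<le> Suc s * ?f" by auto
    then obtain val where val: "\<And>s. s \<le> ?d \<Longrightarrow> val s \<in> Z \<and> s * ?f < val s \<and> val s \<le> Suc s * ?f"
      by (metis atMost_iff)
    have lt: "val s < val t" if "s < t" "t \<le> ?d" for s t
    proof -
      have "val s \<le> Suc s * ?f" using val[of s] that by simp
      also have "\<dots> \<le> t * ?f" using that by (intro mult_le_mono1) simp
      also have "\<dots> < val t" using val[of t] that by simp
      finally show ?thesis .
    qed
    have "inj_on val {..?d}"
      by (rule linorder_inj_onI) (use lt in fastforce)+
    then have "card {..?d} \<le> card Z"
      by (rule card_inj_on_le) (use val Z in auto)
    then show False using Z by simp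
  qed
  then obtain s where s: "s \<le> ?d" "\<And>w. w \<in> Z \<Longrightarrow> w \<le> Suc s * ?f \<Longrightarrow> w \<le> s * ?f"
    using not_less by blast
  have step: "walk A R k w y \<Longrightarrow> disc p w \<le> s * ?f \<Longrightarrow> disc p y \<le> s * ?f" for k w y
  proof (induction k arbitrary: w)
    case (Suc k)
    then obtain w' where w': "w \<in> A" "w' \<in> A" "R w w'" "walk A R k w' y" by auto
    have "disc p w' \<le> disc p w + disc w w'" by (rule disc_triangle)
    also have "disc w w' = ?f" using disc_cong[of w w' u v] R(2)[OF w'(3)] w' AV uv by simp
    finally have "disc p w' \<le> Suc s * ?f" using Suc.prems(2) by simp
    \<comment> \<open>The value lies in \<open>Z\<close>, so not in the gap. The case
      \<open>p = w'\<close> is separate because \<open>Z\<close> only collects pairs of distinct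
      vertices.\<close>
    then have "disc p w' \<le> s * ?f"
      using s(2)[of "disc p w'"] pq w' unfolding Z_def by (cases "p = w'") auto
    then show ?case using Suc.IH[OF w'(4)] by simp
  qed auto
  obtain k where "walk A R k p q" using R(1) pq unfolding connected_graph_def by blast
  then have "disc p q \<le> s * ?f" by (rule step) simp
  also have "\<dots> \<le> (?d + 1) * ?f" using s(1) by (intro mult_le_mono1) simp
  finally show False using big by simp
qed

section \<open>Colour classes and dominant spheres\<close>

lemma card_classes: "b 0 > 0 \<Longrightarrow> card A = card (V - A)"
proof -
  assume b0: "b 0 > 0"
  have "card {y \<in> V - A. E x y} = b 0" if "x \<in> A" for x
  proof -
    have "{y \<in> V - A. E x y} = {y\<in>V. E x y}" using colour that by auto
    then show ?thesis using degree that A_sub by auto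
  qed
  moreover have "card {x \<in> A. E x y} = b 0" if "y \<in> V - A" for y
  proof -
    have "{x \<in> A. E x y} = {x\<in>V. E y x}" using colour that E_sym A_sub by blast
    then show ?thesis using degree that by auto
  qed
  ultimately show ?thesis using double_count[of A "V - A" E] b0 by simp
qed

text \<open>Averaging over pairs \<open>(y, z)\<close> from \<open>A\<close> and \<open>P\<close>.
  For each \<open>y\<close>, all but at most \<open>M\<close> of the \<open>z\<close> are
  equidistant from \<open>p\<close> and \<open>y\<close>; for each \<open>z\<close>, such
  \<open>y\<close> lie on the sphere of radius \<open>D p z\<close> about \<open>z\<close>. As
  \<open>A\<close> and \<open>P\<close> have equal size, some \<open>z\<close> reaches the
  average.\<close>

lemma dominant_distance:
  assumes p: "p \<in> A" and P: "P \<subseteq> V" "card P = card A"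
    and M: "\<And>y. y \<in> A \<Longrightarrow> disc p y \<le> M"
  shows "\<exists>z\<in>P. card A \<le> sphere (D p z) + M"
proof (rule ccontr)
  assume "\<not> ?thesis"
  then have lt: "\<And>z. z \<in> P \<Longrightarrow> sphere (D p z) + M < card A" by force
  have fin: "finite A" "finite P" using finite_subset[OF P(1)] by simp_all
  have ne: "P \<noteq> {}" using P p fin by auto
  have pV: "p \<in> V" using p A_sub by auto
  have "card P \<le> card {z \<in> P. D p z = D y z} + M" if "y \<in> A" for y
  proof -
    have "card P \<le> card ({z \<in> P. D p z = D y z} \<union> {z\<in>V. D p z \<noteq> D y z})"
      using P fin by (intro card_mono) auto
    also have "\<dots> \<le> card {z \<in> P. D p z = D y z} + disc p y" unfolding disc_def by (rule card_Un_le)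
    finally show ?thesis using M[OF that] by simp
  qed
  then have "(\<Sum>y\<in>A. card P) \<le> (\<Sum>y\<in>A. card {z \<in> P. D p z = D y z} + M)" by (rule sum_mono)
  also have "\<dots> = (\<Sum>z\<in>P. card {y \<in> A. D p z = D y z}) + card P * M"
    using double_count[OF fin, of "\<lambda>y z. D p z = D y z"] P by (simp add: sum.distrib)
  also have "\<dots> \<le> (\<Sum>z\<in>P. sphere (D p z)) + card P * M"
  proof -
    have "card {y \<in> A. D p z = D y z} \<le> sphere (D p z)" if "z \<in> P" for z
    proof -
      have "card {y \<in> A. D p z = D y z} \<le> card {y\<in>V. D z y = D p z}"
        using A_sub dist_sym[of z] by (intro card_mono) auto
      then show ?thesis using card_sphere[of z] that P by auto
    qed
    then show ?thesis by (simp add: sum_mono)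
  qed
  also have "\<dots> = (\<Sum>z\<in>P. sphere (D p z) + M)" by (simp add: sum.distrib)
  also have "\<dots> < (\<Sum>z\<in>P. card A)" by (rule sum_strict_mono) (use fin ne lt in auto)
  finally show False using P by simp
qed

text \<open>The two spheres about \<open>p\<close> are disjoint and lie in the same colour
  class.\<close>

lemma sphere_add_le:
  assumes "p \<in> A" "i \<noteq> j" "even i \<longleftrightarrow> even j" "card (V - A) = card A"
  shows "sphere i + sphere j \<le> card A"
proof -
  have p: "p \<in> V" using assms A_sub by auto
  have "sphere i + sphere j = card ({z\<in>V. D p z = i} \<union> {z\<in>V. D p z = j})"
    unfolding card_sphere[OF p, symmetric] using assms(2) by (subst card_Un_disjoint) auto
  also have "\<dots> \<le> card (if even i then A else V - A)"
    using dist_parity[OF p] assms(1,3) by (intro card_mono) auto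
  finally show ?thesis using assms(4) by (simp split: if_splits)
qed

text \<open>The neighbourhoods of \<open>x\<close> and \<open>y\<close> are disjoint, as the
  distance exceeds 2, and lie in the same colour class.\<close>

lemma twice_degree_le:
  assumes "x \<in> V" "y \<in> V" "D x y = 4" "card (V - A) = card A"
  shows "2 * b 0 \<le> card A"
proof -
  have disj: "{w\<in>V. E x w} \<inter> {w\<in>V. E y w} = {}"
  proof -
    have False if "E x w" "E y w" for w
      using dist_triangle[of x w y] dist_edge[OF that(1)] dist_edge[OF that(2)] dist_sym[of w y]
        assms E_in_V[OF that(1)] by auto
    then show ?thesis by auto
  qed
  have "x \<in> A \<longleftrightarrow> y \<in> A" using dist_parity[of x y] assms by simp
  then have "{w\<in>V. E x w} \<union> {w\<in>V. E y w} \<subseteq> (if x \<in> A then V - A else A)" using colour by auto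
  then have "card ({w\<in>V. E x w} \<union> {w\<in>V. E y w}) \<le> card (if x \<in> A then V - A else A)"
    by (intro card_mono) auto
  also have "\<dots> = card A" using assms(4) by simp
  also have "card ({w\<in>V. E x w} \<union> {w\<in>V. E y w}) = 2 * b 0"
    using degree assms disj by (subst card_Un_disjoint) auto
  finally show ?thesis .
qed

section \<open>Moved vertices in consecutive spheres\<close>

lemma card_fixed_neighbours_le:
  assumes "automorphism V E \<sigma>" "y \<in> V" "\<sigma> y \<noteq> y"
  shows "card {z\<in>V. E y z \<and> \<sigma> z = z} \<le> c 2"
proof (cases "{z\<in>V. E y z \<and> \<sigma> z = z} = {}")
  case False
  have sV: "\<sigma> y \<in> V" using assms unfolding automorphism_def bij_betw_def by auto
  \<comment> \<open>A fixed neighbour of \<open>y\<close> is also adjacent to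
    \<open>\<sigma> y\<close>, so it is one of the \<open>c 2\<close> common neighbours of two
    vertices at distance 2.\<close>
  have common: "E (\<sigma> y) z" if "E y z" "\<sigma> z = z" "z \<in> V" for z
    using assms that unfolding automorphism_def by metis
  obtain z where z: "z \<in> V" "E y z" "\<sigma> z = z" using False by auto
  have e: "E z y" "E (\<sigma> y) z" using z common E_sym by auto
  have "D (\<sigma> y) y = D (\<sigma> y) z + 1 \<or> D (\<sigma> y) y + 1 = D (\<sigma> y) z"
    by (rule dist_adjacent[OF sV e(1)])
  then have D2: "D (\<sigma> y) y = 2" using dist_edge[OF e(2)] dist_eq_0[OF sV assms(2)] assms(3) by auto
  have "{z\<in>V. E y z \<and> \<sigma> z = z} \<subseteq> {z\<in>V. E y z \<and> D (\<sigma> y) z + 1 = D (\<sigma> y) y}"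
    using common dist_edge D2 by auto
  then have "card {z\<in>V. E y z \<and> \<sigma> z = z} \<le> card {z\<in>V. E y z \<and> D (\<sigma> y) z + 1 = D (\<sigma> y) y}"
    by (intro card_mono) auto
  then show ?thesis using c_count[OF sV assms(2)] D2 by simp
next
  case True
  show ?thesis unfolding True by simp
qed

text \<open>A moved vertex at distance \<open>i\<close> has at least \<open>b i - c 2\<close> moved
  neighbours at distance \<open>Suc i\<close>, and a vertex there has \<open>c (Suc i)\<close>
  neighbours at distance \<open>i\<close>. Compared with \<open>sphere_rec\<close>, the moved
  fraction is multiplied by at least 2/3.\<close>

lemma moved_sphere_ge:
  assumes \<sigma>: "automorphism V E \<sigma>" and u: "u \<in> V" "\<sigma> u \<noteq> u"
    and b: "\<And>i. i < T \<Longrightarrow> 3 * c 2 \<le> b i" and c: "\<And>i. i < T \<Longrightarrow> 0 < c (Suc i)"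
  shows "i \<le> T \<Longrightarrow> 2 ^ i * sphere i \<le> 3 ^ i * card {y\<in>V. \<sigma> y \<noteq> y \<and> D u y = i}"
proof (induction i)
  case 0
  have "{z\<in>V. D u z = 0} = {u}" "{y\<in>V. \<sigma> y \<noteq> y \<and> D u y = 0} = {u}" using dist_eq_0 u by auto
  then show ?case using card_sphere[OF u(1), of 0] by simp
next
  case (Suc i)
  let ?P = "{y\<in>V. \<sigma> y \<noteq> y \<and> D u y = i}" and ?Q = "{y\<in>V. \<sigma> y \<noteq> y \<and> D u y = Suc i}"
  have "b i \<le> card {z \<in> ?Q. E y z} + c 2" if y: "y \<in> ?P" for y
  proof -
    have "b i = card {z\<in>V. E y z \<and> D u z = D u y + 1}" using b_count[of u y] u y by simp
    also have "\<dots> \<le> card ({z \<in> ?Q. E y z} \<union> {z\<in>V. E y z \<and> \<sigma> z = z})"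
      using y by (intro card_mono) auto
    also have "\<dots> \<le> card {z \<in> ?Q. E y z} + card {z\<in>V. E y z \<and> \<sigma> z = z}" by (rule card_Un_le)
    finally show ?thesis using card_fixed_neighbours_le[OF \<sigma>, of y] y by simp
  qed
  then have "(\<Sum>y\<in>?P. b i) \<le> (\<Sum>y\<in>?P. card {z \<in> ?Q. E y z} + c 2)" by (rule sum_mono)
  also have "\<dots> = (\<Sum>z\<in>?Q. card {y \<in> ?P. E y z}) + card ?P * c 2"
    using double_count[of ?P ?Q E] by (simp add: sum.distrib)
  also have "(\<Sum>z\<in>?Q. card {y \<in> ?P. E y z}) \<le> (\<Sum>z\<in>?Q. c (Suc i))"
  proof (rule sum_mono)
    fix z assume z: "z \<in> ?Q"
    have "card {y \<in> ?P. E y z} \<le> card {y\<in>V. E z y \<and> D u y + 1 = D u z}"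
      using z E_sym by (intro card_mono) auto
    then show "card {y \<in> ?P. E y z} \<le> c (Suc i)" using c_count[of u z] u z by simp
  qed
  finally have PQ: "card ?P * b i \<le> card ?Q * c (Suc i) + card ?P * c 2" by simp
  have "card ?P * (3 * c 2) \<le> card ?P * b i" using b[of i] Suc.prems by (intro mult_le_mono2) simp
  with PQ have PQ': "2 * (card ?P * b i) \<le> 3 * (card ?Q * c (Suc i))"
    unfolding mult.left_commute[of _ 3] by linarith
  \<comment> \<open>The factor \<open>c (Suc i)\<close> makes \<open>sphere_rec\<close> applicable;
    it is positive and cancels at the end.\<close>
  have "2 ^ Suc i * sphere (Suc i) * c (Suc i) = 2 * (2 ^ i * sphere i) * b i"
    using sphere_rec[of i] by simp
  also have "\<dots> \<le> 2 * (3 ^ i * card ?P) * b i"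
    using Suc by (intro mult_le_mono1 mult_le_mono2) simp
  also have "\<dots> = 3 ^ i * (2 * (card ?P * b i))" by simp
  also have "\<dots> \<le> 3 ^ i * (3 * (card ?Q * c (Suc i)))" using PQ' by (rule mult_le_mono2)
  also have "\<dots> = 3 ^ Suc i * card ?Q * c (Suc i)" by simp
  finally show ?case using c[of i] Suc.prems by simp
qed

text \<open>From radius \<open>T - 1\<close> to \<open>T\<close> the sphere grows from at most a
  quarter to at least three quarters of a class, so \<open>sphere_rec\<close> gives
  \<open>3 * c T \<le> b (T - 1)\<close>; then \<open>c 2 \<le> c T\<close>.\<close>

lemma dominant_pair_bound:
  assumes p: "p \<in> A" and T: "z \<in> V" "D p z = T" and TT': "T < T'" "even T \<noteq> even T'"
    and dom: "3 * card A \<le> 4 * sphere T" "3 * card A \<le> 4 * sphere T'"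
    and half: "card (V - A) = card A" "2 * b 0 \<le> card A" "0 < b 0"
  shows "2 \<le> T \<and> 3 * c 2 \<le> b (T - 1)"
proof -
  have pV: "p \<in> V" using p A_sub by auto
  have "{z\<in>V. D p z = 0} = {p}" using dist_eq_0 pV by auto
  then have s0: "sphere 0 = 1" using card_sphere[OF pV, of 0] by simp
  have "{z\<in>V. D p z = 1} = {z\<in>V. E p z}" using dist_edge dist_1_edge pV by auto
  then have s1: "sphere 1 = b 0" using card_sphere[OF pV, of 1] degree[OF pV] by simp
  \<comment> \<open>The spheres of radius 0 and 1 have sizes 1 and \<open>b 0\<close>, at most half
    of \<open>card A\<close>.\<close>
  have T2: "2 \<le> T"
  proof (rule ccontr)
    assume "\<not> 2 \<le> T"
    then have "T = 0 \<or> T = 1" by auto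
    then show False using dom(1) s0 s1 half by auto
  qed
  then obtain t where t: "T = Suc t" by (cases T) auto
  \<comment> \<open>\<open>t\<close> and \<open>T'\<close> have the same parity, and
    \<open>t < T'\<close>.\<close>
  have "sphere t + sphere T' \<le> card A"
    by (rule sphere_add_le) (use p TT' t half in auto)
  then have "4 * sphere t \<le> card A" using dom(2) by simp
  then have upper: "4 * sphere t * b t \<le> card A * b t" by (rule mult_le_mono1)
  have "card A * (3 * c T) = 3 * card A * c T" by simp
  also have "\<dots> \<le> 4 * sphere T * c T" using dom(1) by (rule mult_le_mono1)
  also have "\<dots> = 4 * sphere t * b t" using sphere_rec[of t] t by simp
  also note upper
  finally have "3 * c T \<le> b t" using half by simp
  moreover have "c 2 \<le> c T" using c_mono[of p z 2] T pV T2 by simp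
  ultimately show ?thesis using T2 t by simp
qed

section \<open>The bound for a single automorphism\<close>

lemma card_le_moved:
  assumes diam: "4 \<le> diameter V E" and \<sigma>: "automorphism V E \<sigma>" and moved: "w \<in> V" "\<sigma> w \<noteq> w"
    and prim: "primitive A F" and F: "F = (\<lambda>u v. u \<in> A \<and> v \<in> A \<and> dist_graph V E 2 u v)"
    and A_conn: "connected_graph A F"
  shows "card V \<le> 8 * 3 ^ diameter V E * card {v\<in>V. \<sigma> v \<noteq> v}"
proof -
  let ?d = "diameter V E" and ?S = "{v\<in>V. \<sigma> v \<noteq> v}"
  have AV: "\<And>x. x \<in> A \<Longrightarrow> x \<in> V" using A_sub by auto
  have \<sigma>V: "\<And>x. x \<in> V \<Longrightarrow> \<sigma> x \<in> V" using \<sigma> unfolding automorphism_def bij_betw_def by auto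
  obtain x0 y0 where x0: "x0 \<in> V" "y0 \<in> V" "D x0 y0 = ?d" by (rule diameter_attained)
  \<comment> \<open>Distance 4 is for \<open>twice_degree_le\<close>; distance 3 yields
    \<open>0 < b 2\<close>.\<close>
  obtain x4 where x4: "x4 \<in> V" "D x0 x4 = 4"
    using dist_split[of x0 y0 4 "?d - 4"] x0 diam by auto
  obtain x3 where x3: "x3 \<in> V" "D x0 x3 = 3"
    using dist_split[of x0 x4 3 1] x0 x4 by auto
  have b2: "0 < b 2" using b_pos[of x0 x3 2] x0 x3 by simp
  have b0: "0 < b 0" using b_antimono[of x0 x3 0 2] x0 x3 b2 by simp
  have half: "card (V - A) = card A" using card_classes b0 by simp
  have deg: "2 * b 0 \<le> card A" using twice_degree_le[of x0 x4] x0 x4 half by simp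
  have n: "card V = 2 * card A" using half card_Diff_subset[OF finite_A A_sub] card_mono[OF finite_V A_sub]
    by linarith
  have disc_S: "disc u (\<sigma> u) \<le> card ?S" if "u \<in> V" for u
  proof -
    \<comment> \<open>If \<open>z\<close> were fixed, \<open>D (\<sigma> u) z\<close> would equal
      \<open>D (\<sigma> u) (\<sigma> z) = D u z\<close>.\<close>
    have "\<sigma> z \<noteq> z" if "z \<in> V" "D u z \<noteq> D (\<sigma> u) z" for z
      using automorphism_dist[OF \<sigma> \<open>u \<in> V\<close> that(1)] that(2) by auto
    then show ?thesis unfolding disc_def by (intro card_mono) auto
  qed
  obtain u where u: "u \<in> A" "\<sigma> u \<noteq> u"
  proof -
    have "\<exists>u\<in>A. \<sigma> u \<noteq> u"
    proof (rule ccontr)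
      assume fix_A: "\<not> ?thesis"
      then have "w \<notin> A" using moved by auto
      \<comment> \<open>All neighbours of \<open>w\<close> lie in \<open>A\<close> and are fixed.
        The resulting \<open>b 0 \<le> c 2\<close> contradicts \<open>c 2 + b 2 = b 0\<close> with
        \<open>0 < b 2\<close>.\<close>
      then have "{z\<in>V. E w z} = {z\<in>V. E w z \<and> \<sigma> z = z}" using colour fix_A by auto
      then have "b 0 \<le> c 2" using degree[OF moved(1)] card_fixed_neighbours_le[OF \<sigma> moved] by simp
      moreover obtain x2 where "x2 \<in> V" "D x0 x2 = 2"
        using dist_split[of x0 x4 2 2] x0 x4 by auto
      ultimately show False using c_plus_b[of x0 x2] x0 b2 by simp
    qed
    then show ?thesis using that by blast
  qed
  have pow: "?d + 1 \<le> 3 ^ ?d"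
  proof -
    have "n + 1 \<le> 3 ^ n" for n :: nat by (induction n) auto
    then show ?thesis .
  qed
  show ?thesis
  proof (cases "\<sigma> u \<in> A")
    case False
    \<comment> \<open>Here \<open>u\<close> and \<open>\<sigma> u\<close> have different colours, so
      parity alone distinguishes them at every vertex.\<close>
    have "{z\<in>V. D u z \<noteq> D (\<sigma> u) z} = V"
    proof -
      have "even (D u z) \<noteq> even (D (\<sigma> u) z)" if "z \<in> V" for z
        using dist_parity[of u z] dist_parity[of "\<sigma> u" z] False u AV \<sigma>V that by simp
      then show ?thesis by force
    qed
    then have "card V \<le> card ?S" using disc_S[of u] AV u unfolding disc_def by simp
    also have "\<dots> \<le> 8 * 3 ^ ?d * card ?S" by simp
    finally show ?thesis .
  next
    case True
    let ?i = "gdist A F u (\<sigma> u)" and ?M = "(?d + 1) * card ?S"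
    have hd: "\<And>x y. x \<in> A \<Longrightarrow> y \<in> A \<Longrightarrow> D x y = 2 * gdist A F x y" by (rule halved_dist(1)[OF F])
    have "simple_graph A F"
      using dist_sym F dist_eq_0 AV unfolding simple_graph_def dist_graph_def by auto
    then interpret H: conn_graph A F using A_conn by unfold_locales
    have "1 \<le> ?i" using dist_eq_0[of u "\<sigma> u"] u True AV hd[of u "\<sigma> u"] by (cases ?i) auto
    moreover have "?i \<le> diameter A F" using H.dist_le_diameter u True by simp
    ultimately have R: "connected_graph A (dist_graph A F ?i)" using prim unfolding primitive_def by auto
    have M: "disc p q \<le> ?M" if "p \<in> A" "q \<in> A" for p q
    proof -
      have "disc p q \<le> (?d + 1) * disc u (\<sigma> u)"
        by (rule disc_le_of_connected[OF _ _ _ R])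
          (use u True that hd in \<open>auto simp: dist_graph_def\<close>)
      also have "\<dots> \<le> ?M" using disc_S[of u] u AV by (intro mult_le_mono2) simp
      finally show ?thesis .
    qed
    show ?thesis
    \<comment> \<open>Below the threshold, \<open>?d + 1 \<le> 3 ^ ?d\<close> suffices, and 8 is 4
      times the factor in \<open>card V = 2 * card A\<close>. Above it, \<open>card A - ?M\<close>
      is at least three quarters of \<open>card A\<close>.\<close>
    proof (cases "card A < 4 * ?M")
      case True
      then have "card V \<le> 8 * ((?d + 1) * card ?S)" using n by simp
      also have "\<dots> \<le> 8 * (3 ^ ?d * card ?S)" using pow by (intro mult_le_mono2 mult_le_mono1)
      finally show ?thesis by (simp only: mult.assoc)
    next
      case False
      \<comment> \<open>Averaging over \<open>A\<close> yields an even dominant distance, averaging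
        over \<open>V - A\<close> an odd one.\<close>
      obtain z where z: "z \<in> A" "card A \<le> sphere (D u z) + ?M"
        using dominant_distance[OF u(1) A_sub refl, of ?M] M u by blast
      obtain z' where z': "z' \<in> V - A" "card A \<le> sphere (D u z') + ?M"
        using dominant_distance[OF u(1) _ half, of ?M] M u by blast
      have par: "even (D u z)" "odd (D u z')" using dist_parity[of u] u z z' AV by auto
      have dom: "3 * card A \<le> 4 * sphere (D u z)" "3 * card A \<le> 4 * sphere (D u z')"
        using z z' False by auto
      \<comment> \<open>\<open>y\<close> realises the smaller of the two distances, which takes the
        role of \<open>T\<close> in \<open>dominant_pair_bound\<close>.\<close>
      obtain y where y: "y \<in> V" "2 \<le> D u y" "3 * c 2 \<le> b (D u y - 1)" "3 * card A \<le> 4 * sphere (D u y)"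
      proof (cases "D u z < D u z'")
        case True
        then show ?thesis
          using dominant_pair_bound[OF u(1) _ refl True _ dom half deg b0] AV[OF z(1)] par that[of z] dom
          by auto
      next
        case False
        then have "D u z' < D u z" using par by (metis linorder_neqE_nat)
        then show ?thesis
          using dominant_pair_bound[OF u(1) _ refl _ _ dom(2,1) half deg b0] z' par that[of z'] dom
          by auto
      qed
      let ?T = "D u y"
      have "2 ^ ?T * sphere ?T \<le> 3 ^ ?T * card {v\<in>V. \<sigma> v \<noteq> v \<and> D u v = ?T}"
      proof (rule moved_sphere_ge[OF \<sigma> _ u(2) _ _ order_refl])
        show "u \<in> V" using u AV by simp
        fix i assume i: "i < ?T"
        \<comment> \<open>Since \<open>b\<close> does not increase up to \<open>?T\<close>, the
          bound at \<open>?T - 1\<close> is the worst case.\<close>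
        show "3 * c 2 \<le> b i" using b_antimono[of u y i "?T - 1"] i y u AV by fastforce
        obtain x where "x \<in> V" "D u x = Suc i"
          using dist_split[of u y "Suc i" "?T - Suc i"] i y u AV by auto
        then show "0 < c (Suc i)" using c_pos[of u x i] u AV by simp
      qed
      also have "\<dots> \<le> 3 ^ ?d * card ?S"
        using dist_le_diameter[of u y] y u AV
        by (intro mult_le_mono power_increasing card_mono) auto
      finally have "2 ^ ?T * sphere ?T \<le> 3 ^ ?d * card ?S" .
      moreover have "1 * sphere ?T \<le> 2 ^ ?T * sphere ?T" by (intro mult_le_mono1) simp
      ultimately have "sphere ?T \<le> 3 ^ ?d * card ?S" by linarith
      then show ?thesis using y(4) n unfolding mult.assoc by linarith
    qed
  qed
qed

end

section \<open>The bound for the motion\<close>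

theorem theorem5p4:
  fixes V :: "'a set" and E :: "'a \<Rightarrow> 'a \<Rightarrow> bool" and d :: nat
  assumes "distance_regular V E" and "bipartite V E"
    and "diameter V E = d" and "d \<ge> 4"
    and "\<exists>C F. halved_graph V E C F \<and> primitive C F"
  shows "motion V E \<ge> ereal ((2 * real d) powr (- (2 * real d) - 5) * real (card V))"
proof -
  obtain C F where CF: "component V (dist_graph V E 2) C" "primitive C F"
    and F: "F = (\<lambda>u v. u \<in> C \<and> v \<in> C \<and> dist_graph V E 2 u v)"
    using assms(5) unfolding halved_graph_def by blast
  obtain A where A: "A \<subseteq> V" "\<And>u v. E u v \<Longrightarrow> u \<in> A \<longleftrightarrow> v \<notin> A"
    using assms(2) unfolding bipartite_def by blast
  obtain c b :: "nat \<Rightarrow> nat" where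
    cb: "\<And>v w. v \<in> V \<Longrightarrow> w \<in> V \<Longrightarrow>
      card {x\<in>V. E w x \<and> gdist V E v x + 1 = gdist V E v w} = c (gdist V E v w) \<and>
      card {x\<in>V. E w x \<and> gdist V E v x = gdist V E v w + 1} = b (gdist V E v w)"
    and gr: "simple_graph V E" "connected_graph V E"
  proof -
    have "simple_graph V E" "connected_graph V E" using assms(1) unfolding distance_regular_def by auto
    moreover obtain c a b :: "nat \<Rightarrow> nat" where "\<forall>v\<in>V. \<forall>w\<in>V.
        card {x\<in>V. E w x \<and> gdist V E v x + 1 = gdist V E v w} = c (gdist V E v w) \<and>
        card {x\<in>V. E w x \<and> gdist V E v x = gdist V E v w} = a (gdist V E v w) \<and>
        card {x\<in>V. E w x \<and> gdist V E v x = gdist V E v w + 1} = b (gdist V E v w)"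
      using assms(1) unfolding distance_regular_def Let_def by blast
    ultimately show thesis using that[of c b] by blast
  qed
  \<comment> \<open>An arbitrary colour class \<open>A\<close> serves to recognise \<open>C\<close>
    as a colour class; the second interpretation then puts \<open>C\<close> in its place, whichever
    class it is.\<close>
  interpret G: bip_graph V E A by unfold_locales (use gr A in blast)+
  obtain v where v: "v \<in> V" "C = {y \<in> V. even (gdist V E v y)}"
    by (rule G.component_dist2[OF CF(1)])
  have colour_C: "u \<in> C \<longleftrightarrow> w \<notin> C" if "E u w" for u w
    using G.dist_adjacent[OF v(1) that] G.E_in_V[OF that] unfolding v(2) by (auto; presburger)
  interpret X: bip_drg V E C c b
    by unfold_locales (use v(2) colour_C cb in blast)+
  have C_conn: "connected_graph C F"
  proof -
    have "v \<in> C" using v by simp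
    then show ?thesis using X.halved_dist(2)[OF F] unfolding connected_graph_def by blast
  qed
  show ?thesis unfolding motion_def
  proof (rule INF_greatest, clarsimp)
    fix \<sigma> w assume \<sigma>: "automorphism V E \<sigma>" "w \<in> V" "\<sigma> w \<noteq> w"
    let ?s = "card {v\<in>V. \<sigma> v \<noteq> v}"
    have "card V \<le> 8 * 3 ^ d * ?s"
      using X.card_le_moved[OF _ \<sigma> CF(2) F C_conn] assms by simp
    also have "8 * 3 ^ d \<le> (2 * d) ^ (2 * d + 5)"
    proof -
      \<comment> \<open>From \<open>d \<ge> 4\<close>: \<open>8 \<le> 2 * d\<close> and
        \<open>3 \<le> 2 * d\<close>.\<close>
      have "8 * 3 ^ d \<le> (2 * d) * (2 * d) ^ d"
        using assms(4) by (intro mult_le_mono power_mono) auto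
      also have "\<dots> = (2 * d) ^ (d + 1)" by simp
      also have "\<dots> \<le> (2 * d) ^ (2 * d + 5)" using assms(4) by (intro power_increasing) auto
      finally show ?thesis .
    qed
    finally have "card V \<le> (2 * d) ^ (2 * d + 5) * ?s" by simp
    then have "real (card V) \<le> real ((2 * d) ^ (2 * d + 5) * ?s)" by (simp only: of_nat_le_iff)
    then have le: "real (card V) \<le> (2 * real d) ^ (2 * d + 5) * real ?s" by simp
    have "(2 * real d) powr (- (2 * real d) - 5) = inverse ((2 * real d) powr real (2 * d + 5))"
      by (simp add: powr_minus[symmetric])
    also have "\<dots> = inverse ((2 * real d) ^ (2 * d + 5))"
      using assms(4) by (subst powr_realpow) auto
    finally have eq: "(2 * real d) powr (- (2 * real d) - 5) = inverse ((2 * real d) ^ (2 * d + 5))" .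
    have inverse_mult_le: "0 < N \<Longrightarrow> x \<le> N * y \<Longrightarrow> inverse N * x \<le> y" for N x y :: real
      by (simp add: field_simps)
    have "0 < (2 * real d) ^ (2 * d + 5)" using assms(4) by simp
    then show "(2 * real d) powr (- (2 * real d) - 5) * real (card V) \<le> real ?s"
      unfolding eq using le by (rule inverse_mult_le)
  qed
qed

end
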